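(* Let $G$ be a finite group and $S\subseteq G$ a symmetric generating set of $G$ not containing the identity, closed under conjugation, with $|S|=d$. Suppose the Cayley sum graph $C_\Sigma(G,S)$ is an $\varepsilon$-vertex expander for some $\varepsilon>0$ and is not bipartite. Then every eigenvalue of the normalised adjacency matrix of $C_\Sigma(G,S)$ is greater than $-1+\frac{\varepsilon^4}{2^9d^8}$.
   Context: The Cayley sum graph $C_\Sigma(G,S)$ has vertex set $G$, and $h$ is adjacent to $g$ iff $h=g^{-1}s$ for some $s\in S$, i.e. iff $gh\in S$ (undirected since $S$ is closed under conjugation; loops allowed). Its adjacency matrix has $A_{g,h}=1$ if $gh\in S$ and $0$ otherwise; the normalised adjacency matrix is this matrix divided by $d$. The graph is an $\varepsilon$-vertex expander if $|X^{-1}S\setminus X|\ge\varepsilon|X|$ for every nonempty $X\subseteq G$ with $|X|\le\frac12|G|$. A graph is bipartite if its vertex set is a union of two disjoint sets each containing no edge (in particular no loop). *)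

theory Defs
  imports "HOL-Algebra.Coset" "HOL-Algebra.Generated_Groups" "Jordan_Normal_Form.Char_Poly"
begin

definition cayley_sum_adj :: "('a, 'b) monoid_scheme \<Rightarrow> 'a set \<Rightarrow> 'a \<Rightarrow> 'a \<Rightarrow> bool" where
  "cayley_sum_adj G S g h \<longleftrightarrow>
     g \<in> carrier G \<and> h \<in> carrier G \<and> g \<otimes>\<^bsub>G\<^esub> h \<in> S"

lemma (in group) cayley_sum_adj_iff:
  assumes "S \<subseteq> carrier G" "g \<in> carrier G" "h \<in> carrier G"
  shows "cayley_sum_adj G S g h \<longleftrightarrow> (\<exists>s\<in>S. h = inv g \<otimes> s)"
proof
  assume "cayley_sum_adj G S g h"
  then have "g \<otimes> h \<in> S" by (simp add: cayley_sum_adj_def)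
  moreover have "h = inv g \<otimes> (g \<otimes> h)"
    using assms by (simp add: m_assoc[symmetric])
  ultimately show "\<exists>s\<in>S. h = inv g \<otimes> s" by blast
next
  assume "\<exists>s\<in>S. h = inv g \<otimes> s"
  then obtain s where s: "s \<in> S" "h = inv g \<otimes> s" by blast
  then have "g \<otimes> h = s"
    using assms by (auto simp: m_assoc[symmetric])
  then show "cayley_sum_adj G S g h"
    using s assms by (simp add: cayley_sum_adj_def)
qed

text \<open>
  The case \<open>g = h\<close> is included below, so a loop on either side is excluded as well.
  One of the two sides may be empty.
\<close>
definition bipartite :: "'a set \<Rightarrow> ('a \<Rightarrow> 'a \<Rightarrow> bool) \<Rightarrow> bool" where
  "bipartite V adj \<longleftrightarrow>
     (\<exists>A B. A \<union> B = V \<and> A \<inter> B = {} \<and>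
        (\<forall>g\<in>A. \<forall>h\<in>A. \<not> adj g h) \<and> (\<forall>g\<in>B. \<forall>h\<in>B. \<not> adj g h))"

definition cayley_sum_vertex_expander ::
    "('a, 'b) monoid_scheme \<Rightarrow> 'a set \<Rightarrow> real \<Rightarrow> bool" where
  "cayley_sum_vertex_expander G S \<epsilon> \<longleftrightarrow>
     (\<forall>X \<subseteq> carrier G. X \<noteq> {} \<and> real (card X) \<le> 1 / 2 * real (card (carrier G)) \<longrightarrow>
        real (card ((set_inv\<^bsub>G\<^esub> X <#>\<^bsub>G\<^esub> S) - X)) \<ge> \<epsilon> * real (card X))"

text \<open>
  Matrices are indexed by natural numbers, so the list \<open>gs\<close> enumerates the carrier of \<open>G\<close>
  without repetition. Another enumeration conjugates the matrix by a permutation matrix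
  and does not change the eigenvalues.
\<close>
definition cayley_sum_adj_matrix ::
    "('a, 'b) monoid_scheme \<Rightarrow> 'a set \<Rightarrow> 'a list \<Rightarrow> real mat" where
  "cayley_sum_adj_matrix G S gs =
     mat (length gs) (length gs)
       (\<lambda>(i, j). if gs ! i \<otimes>\<^bsub>G\<^esub> gs ! j \<in> S then 1 else 0)"

definition cayley_sum_normalised_adj_matrix ::
    "('a, 'b) monoid_scheme \<Rightarrow> 'a set \<Rightarrow> 'a list \<Rightarrow> real mat" where
  "cayley_sum_normalised_adj_matrix G S gs =
     (1 / real (card S)) \<cdot>\<^sub>m cayley_sum_adj_matrix G S gs"

end

theory Submission
  imports Defs
begin

text \<open>
  Write \<open>n = |G|\<close> and let \<open>B\<close> be the adjacency operator of the Cayley graph,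
  \<open>(B f)(g) = (\<Sum>s\<in>S. f (g s))\<close>. It commutes with the inversion \<open>\<iota>\<close>, and the sum graph has
  adjacency operator \<open>B \<circ> \<iota>\<close>. An eigenfunction of the latter for an eigenvalue near \<open>- d\<close>
  therefore yields either an even eigenfunction of \<open>B\<close> near \<open>- d\<close> or an odd one near \<open>d\<close>.
  Put \<open>\<beta> = \<epsilon>\<^sup>2 / (16 d ^ 4)\<close>, so that \<open>\<beta>\<^sup>2 / 2\<close> is the claimed gap. Cutting the eigenfunction
  at a suitable level (as in Cheeger's and Trevisan's inequalities) gives a sign function
  \<open>\<chi> : G \<rightarrow> {- 1, 0, 1}\<close> with \<open>\<chi> (g s) = \<plusminus> \<chi> g\<close> for all but \<open>d \<beta> |supp \<chi>|\<close> of the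
  pairs \<open>(g, s)\<close> with \<open>g\<close> in the support.

  Expansion of the sum graph controls the sets \<open>Y = Y\<inverse>\<close> only. For arbitrary \<open>Y\<close> with
  small edge boundary in the Cayley graph, looking at \<open>Y \<inter> Y\<inverse>\<close> and \<open>Y \<union> Y\<inverse>\<close> shows that
  \<open>|Y|\<close> is close to \<open>0\<close>, \<open>n\<close> or \<open>n / 2\<close>. The middle case is impossible: \<open>|Y \<inter> Y x|\<close> would
  avoid all values well between \<open>0\<close> and \<open>n / 2\<close> but vary slowly along generators, hence
  stay near \<open>n / 2\<close> for every \<open>x\<close>, whereas its average over \<open>x\<close> is \<open>|Y|\<^sup>2 / n\<close>, about \<open>n / 4\<close>.

  In the odd case the set where \<open>\<chi> > 0\<close> contradicts this. In the even case it applies to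
  \<open>Z x = {g. \<chi> (g x) = \<chi> g \<noteq> 0}\<close>, and the elements \<open>x\<close> for which \<open>Z x\<close> is almost all of \<open>G\<close>
  form one side of a bipartition.
\<close>

section \<open>Level sets and a pointwise Cheeger inequality\<close>

text \<open>The sum of \<open>c i * v i\<close> is the integral over \<open>t > 0\<close> of the
  total weight \<open>c\<close> of the level set at \<open>t\<close>, so some level has weight at
  most 0. The induction peels off the lowest positive layer, which leaves fewer positive
  values.\<close>

lemma threshold_sum_nonpos:
  fixes c v :: "'i \<Rightarrow> real"
  assumes "finite I" "\<And>i. i \<in> I \<Longrightarrow> 0 \<le> v i" "\<exists>i\<in>I. 0 < v i" "(\<Sum>i\<in>I. c i * v i) \<le> 0"
  shows "\<exists>t>0. (\<exists>i\<in>I. t \<le> v i) \<and> sum c {i\<in>I. t \<le> v i} \<le> 0"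
  using assms(2-)
proof (induction "card {i\<in>I. 0 < v i}" arbitrary: v rule: less_induct)
  case less
  define P where "P = {i\<in>I. 0 < v i}"
  have P: "finite P" "P \<noteq> {}" using less.prems assms(1) by (auto simp: P_def)
  define m where "m = Min (v ` P)"
  have mP: "m \<in> v ` P" unfolding m_def using P by (intro Min_in) auto
  then obtain i0 where i0: "i0 \<in> P" "v i0 = m" by auto
  have m_pos: "0 < m" using i0 by (auto simp: P_def)
  have m_le: "m \<le> v i" if "i \<in> P" for i unfolding m_def using P that by (intro Min_le) auto
  have P_eq: "P = {i\<in>I. m \<le> v i}" using m_le m_pos by (auto simp: P_def)
  define w where "w i = (if i \<in> P then v i - m else 0)" for i
  have split: "(\<Sum>i\<in>I. c i * v i) = m * sum c P + (\<Sum>i\<in>I. c i * w i)"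
  proof -
    have "(\<Sum>i\<in>I. c i * v i) = (\<Sum>i\<in>I. (if i \<in> P then m * c i else 0) + c i * w i)"
      using less.prems(1) by (intro sum.cong) (force simp: w_def P_def algebra_simps)+
    also have "\<dots> = (\<Sum>i\<in>I. if i \<in> P then m * c i else 0) + (\<Sum>i\<in>I. c i * w i)"
      by (rule sum.distrib)
    also have "(\<Sum>i\<in>I. if i \<in> P then m * c i else 0) = (\<Sum>i\<in>I \<inter> P. m * c i)"
      using assms(1) by (simp add: sum.inter_restrict)
    also have "I \<inter> P = P" by (auto simp: P_def)
    finally show ?thesis by (simp add: sum_distrib_left)
  qed
  show ?case
  proof (cases "sum c P \<le> 0")
    case True
    then show ?thesis using m_pos i0 P_eq by (intro exI[of _ m]) auto
  next
    case False
    then have neg: "(\<Sum>i\<in>I. c i * w i) < 0"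
      using split less.prems(3) m_pos mult_pos_pos[of m "sum c P"] by linarith
    have nonneg: "0 \<le> w i" if "i \<in> I" for i using m_le by (auto simp: w_def)
    have ex: "\<exists>i\<in>I. 0 < w i"
    proof (rule ccontr)
      assume "\<not> ?thesis"
      then have "\<And>i. i \<in> I \<Longrightarrow> w i = 0" using nonneg by force
      then show False using neg by simp
    qed
    have "{i\<in>I. 0 < w i} \<subseteq> P - {i0}" using i0 by (auto simp: w_def split: if_splits)
    then have "{i\<in>I. 0 < w i} \<subset> {i\<in>I. 0 < v i}" using i0(1) by (auto simp: P_def)
    then have "card {i\<in>I. 0 < w i} < card {i\<in>I. 0 < v i}"
      using assms(1) by (intro psubset_card_mono) auto
    from less.hyps[OF this nonneg ex less_imp_le[OF neg]]
    obtain t where t: "t > 0" "\<exists>i\<in>I. t \<le> w i" "sum c {i\<in>I. t \<le> w i} \<le> 0" by auto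
    \<comment> \<open>Outside \<open>P\<close> both \<open>w\<close> and \<open>v\<close> are 0, and
      on \<open>P\<close> they differ by \<open>m\<close>, so the level sets match.\<close>
    have "t \<le> w i \<longleftrightarrow> t + m \<le> v i" if "i \<in> I" for i
      using t(1) m_pos that by (auto simp: w_def P_def)
    then show ?thesis using t m_pos
      by (intro exI[of _ "t + m"]) (auto cong: conj_cong)
  qed
qed

text \<open>The left side is |a^2 - b^2| if the signs agree up to \<sigma> and a^2 + b^2 otherwise.
  Both are at most |b - \<sigma> a| (|a| + |b|), and AM-GM with weight \<beta> separates the two
  factors, in place of Cauchy-Schwarz in Cheeger's inequality.\<close>

lemma diff_min_squares_le:
  fixes a b \<sigma> \<beta> :: real
  assumes \<sigma>: "\<sigma> = 1 \<or> \<sigma> = - 1" and "\<beta> > 0"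
  shows "a\<^sup>2 + b\<^sup>2 - 2 * (if \<sigma> * a * b > 0 then min (a\<^sup>2) (b\<^sup>2) else 0)
           \<le> (b - \<sigma> * a)\<^sup>2 / \<beta> + \<beta> / 2 * (a\<^sup>2 + b\<^sup>2)"
proof -
  have 1: "a\<^sup>2 + b\<^sup>2 - 2 * (if \<sigma> * a * b > 0 then min (a\<^sup>2) (b\<^sup>2) else 0) \<le> \<bar>b - \<sigma> * a\<bar> * (\<bar>a\<bar> + \<bar>b\<bar>)"
  proof (cases "\<sigma> * a * b > 0")
    case True
    then have "\<bar>b - \<sigma> * a\<bar> = \<bar>\<bar>b\<bar> - \<bar>a\<bar>\<bar>"
      using \<sigma> by (auto simp: abs_if zero_less_mult_iff mult_less_0_iff)
    then have "\<bar>b - \<sigma> * a\<bar> * (\<bar>a\<bar> + \<bar>b\<bar>) = \<bar>(\<bar>b\<bar> - \<bar>a\<bar>) * (\<bar>b\<bar> + \<bar>a\<bar>)\<bar>"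
      by (simp add: abs_mult add.commute)
    also have "(\<bar>b\<bar> - \<bar>a\<bar>) * (\<bar>b\<bar> + \<bar>a\<bar>) = b\<^sup>2 - a\<^sup>2"
      by (simp add: algebra_simps power2_eq_square)
    finally show ?thesis using True by (simp add: min_def abs_if)
  next
    case False
    then have "\<sigma> * a * b \<le> 0" by simp
    then have "\<bar>b - \<sigma> * a\<bar> = \<bar>a\<bar> + \<bar>b\<bar>"
      using \<sigma> by (auto simp: abs_if mult_le_0_iff zero_le_mult_iff)
    then show ?thesis using False
      by (simp add: power2_eq_square algebra_simps abs_mult[symmetric])
  qed
  have 2: "\<bar>b - \<sigma> * a\<bar> * (\<bar>a\<bar> + \<bar>b\<bar>) \<le> (b - \<sigma> * a)\<^sup>2 / \<beta> + \<beta> / 4 * (\<bar>a\<bar> + \<bar>b\<bar>)\<^sup>2"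
  proof -
    have "0 \<le> (\<bar>b - \<sigma> * a\<bar> - \<beta> / 2 * (\<bar>a\<bar> + \<bar>b\<bar>))\<^sup>2 / \<beta>" using assms by simp
    also have "\<dots> = (b - \<sigma> * a)\<^sup>2 / \<beta> + \<beta> / 4 * (\<bar>a\<bar> + \<bar>b\<bar>)\<^sup>2 - \<bar>b - \<sigma> * a\<bar> * (\<bar>a\<bar> + \<bar>b\<bar>)"
      using assms(2) by (simp add: power2_diff power_mult_distrib field_simps power2_eq_square)
    finally show ?thesis by simp
  qed
  have 3: "\<beta> / 4 * (\<bar>a\<bar> + \<bar>b\<bar>)\<^sup>2 \<le> \<beta> / 4 * (2 * (a\<^sup>2 + b\<^sup>2))"
  proof (rule mult_left_mono)
    have "0 \<le> (\<bar>a\<bar> - \<bar>b\<bar>)\<^sup>2" by simp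
    then show "(\<bar>a\<bar> + \<bar>b\<bar>)\<^sup>2 \<le> 2 * (a\<^sup>2 + b\<^sup>2)" by (simp add: power2_sum power2_diff)
  qed (use assms in simp)
  show ?thesis using 1 2 3 by linarith
qed

section \<open>Edge boundaries in the Cayley graph of a conjugation-closed set\<close>

locale normal_generating_set = group G for G (structure) +
  fixes S :: "'a set"
  assumes finite_carrier: "finite (carrier G)"
    and S_subset: "S \<subseteq> carrier G"
    and S_inv: "s \<in> S \<Longrightarrow> inv s \<in> S"
    and S_conj: "g \<in> carrier G \<Longrightarrow> s \<in> S \<Longrightarrow> g \<otimes> s \<otimes> inv g \<in> S"
    and S_generates: "generate G S = carrier G"
begin

lemma S_closed [simp]: "s \<in> S \<Longrightarrow> s \<in> carrier G"
  using S_subset by auto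

lemma finite_S [simp]: "finite S"
  using finite_subset[OF S_subset finite_carrier] .

lemma S_conj': "g \<in> carrier G \<Longrightarrow> s \<in> S \<Longrightarrow> inv g \<otimes> s \<otimes> g \<in> S"
  using S_conj[of "inv g" s] by simp

lemma mult_inv_cancel [simp]:
  "x \<in> carrier G \<Longrightarrow> y \<in> carrier G \<Longrightarrow> x \<otimes> y \<otimes> inv y = x"
  "x \<in> carrier G \<Longrightarrow> y \<in> carrier G \<Longrightarrow> x \<otimes> inv y \<otimes> y = x"
  by (simp_all add: m_assoc)

lemma inv_mult_cancel [simp]:
  "x \<in> carrier G \<Longrightarrow> y \<in> carrier G \<Longrightarrow> inv y \<otimes> (y \<otimes> x) = x"
  "x \<in> carrier G \<Longrightarrow> y \<in> carrier G \<Longrightarrow> y \<otimes> (inv y \<otimes> x) = x"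
  by (simp_all add: m_assoc[symmetric])

lemma bij_betw_right_mult:
  "x \<in> carrier G \<Longrightarrow> bij_betw (\<lambda>g. g \<otimes> x) (carrier G) (carrier G)"
  by (rule bij_betwI[where g = "\<lambda>g. g \<otimes> inv x"]) auto

lemma sum_right_mult:
  "x \<in> carrier G \<Longrightarrow> (\<Sum>g\<in>carrier G. h (g \<otimes> x)) = sum h (carrier G)"
  using sum.reindex_bij_betw[OF bij_betw_right_mult] .

lemma card_right_mult:
  assumes "x \<in> carrier G"
  shows "card {g \<in> carrier G. P (g \<otimes> x)} = card {g \<in> carrier G. P g}"
  by (rule bij_betw_same_card[OF bij_betwI[where f = "\<lambda>g. g \<otimes> x" and g = "\<lambda>g. g \<otimes> inv x"]])
    (use assms in auto)

lemma generate_right_induct: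
  assumes x: "x \<in> carrier G" and one: "Q \<one>"
    and step: "\<And>z s. z \<in> carrier G \<Longrightarrow> s \<in> S \<Longrightarrow> Q z \<Longrightarrow> Q (z \<otimes> s)"
  shows "Q x"
proof -
  have "x \<in> generate G S" using x S_generates by simp
  \<comment> \<open>The starting point \<open>z\<close> is arbitrary so that the product case can
    chain two steps; inverse generators are generators by \<open>S_inv\<close>.\<close>
  then have "\<forall>z\<in>carrier G. Q z \<longrightarrow> Q (z \<otimes> x)"
  proof (induction rule: generate.induct)
    case (eng h1 h2)
    then have "h1 \<in> carrier G" "h2 \<in> carrier G" using S_generates by auto
    then show ?case using eng by (auto simp: m_assoc[symmetric])
  qed (use step S_inv in auto)
  then show ?thesis using one x by force
qed

text \<open>A directed edge is recorded as its start and its generator, so that graph automorphisms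
  act by explicit injections on pairs.\<close>

definition edge_boundary :: "'a set \<Rightarrow> ('a \<times> 'a) set" where
  "edge_boundary Y = {(g, s). g \<in> Y \<and> s \<in> S \<and> g \<otimes> s \<notin> Y}"

lemma finite_edge_boundary [simp]: "Y \<subseteq> carrier G \<Longrightarrow> finite (edge_boundary Y)"
  by (rule finite_subset[where B = "carrier G \<times> S"])
    (auto simp: edge_boundary_def finite_carrier)

lemma finite_sub [simp]: "Y \<subseteq> carrier G \<Longrightarrow> finite Y"
  using finite_subset finite_carrier by auto

lemma card_edge_boundary_inter:
  assumes "A \<subseteq> carrier G" "B \<subseteq> carrier G"
  shows "card (edge_boundary (A \<inter> B)) \<le> card (edge_boundary A) + card (edge_boundary B)"
proof -
  have "card (edge_boundary (A \<inter> B)) \<le> card (edge_boundary A \<union> edge_boundary B)"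
    using assms by (intro card_mono finite_UnI finite_edge_boundary) (auto simp: edge_boundary_def)
  then show ?thesis using card_Un_le le_trans by blast
qed

lemma card_edge_boundary_union:
  assumes "A \<subseteq> carrier G" "B \<subseteq> carrier G"
  shows "card (edge_boundary (A \<union> B)) \<le> card (edge_boundary A) + card (edge_boundary B)"
proof -
  have "card (edge_boundary (A \<union> B)) \<le> card (edge_boundary A \<union> edge_boundary B)"
    using assms by (intro card_mono finite_UnI finite_edge_boundary) (auto simp: edge_boundary_def)
  then show ?thesis using card_Un_le le_trans by blast
qed

text \<open>Each edge is reversed: it starts at \<open>g \<otimes> s\<close> and has generator
  \<open>inv s\<close>.\<close>

lemma card_edge_boundary_compl:
  assumes "Y \<subseteq> carrier G"
  shows "card (edge_boundary (carrier G - Y)) \<le> card (edge_boundary Y)"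
proof (rule card_inj_on_le[where f = "\<lambda>(g, s). (g \<otimes> s, inv s)"])
  show "inj_on (\<lambda>(g, s). (g \<otimes> s, inv s)) (edge_boundary (carrier G - Y))"
    by (rule inj_on_inverseI[where g = "\<lambda>(g, s). (g \<otimes> s, inv s)"])
      (auto simp: edge_boundary_def)
  show "(\<lambda>(g, s). (g \<otimes> s, inv s)) ` edge_boundary (carrier G - Y) \<subseteq> edge_boundary Y"
    using assms S_inv by (auto simp: edge_boundary_def)
qed (use assms in simp)

definition inverses :: "'a set \<Rightarrow> 'a set" where
  "inverses Y = {g \<in> carrier G. inv g \<in> Y}"

text \<open>Inversion is an automorphism of the Cayley graph because \<open>S\<close> is closed
  under conjugation: (g s)^-1 = g^-1 (g s^-1 g^-1).\<close>

lemma card_edge_boundary_inverses: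
  assumes "Y \<subseteq> carrier G"
  shows "card (edge_boundary (inverses Y)) \<le> card (edge_boundary Y)"
proof (rule card_inj_on_le[where f = "\<lambda>(g, s). (inv g, g \<otimes> inv s \<otimes> inv g)"])
  show "inj_on (\<lambda>(g, s). (inv g, g \<otimes> inv s \<otimes> inv g)) (edge_boundary (inverses Y))"
    by (rule inj_on_inverseI[where g = "\<lambda>(g, s). (inv g, g \<otimes> inv s \<otimes> inv g)"])
      (auto simp: edge_boundary_def inverses_def inv_mult_group m_assoc)
  show "(\<lambda>(g, s). (inv g, g \<otimes> inv s \<otimes> inv g)) ` edge_boundary (inverses Y) \<subseteq> edge_boundary Y"
    using S_inv S_conj by (auto simp: edge_boundary_def inverses_def inv_mult_group m_assoc)
qed (use assms in simp)

lemma card_inverses: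
  assumes "Y \<subseteq> carrier G"
  shows "card (inverses Y) = card Y"
  by (rule bij_betw_same_card[OF bij_betwI[where f = "\<lambda>g. inv g" and g = "\<lambda>g. inv g"]])
    (use assms in \<open>auto simp: inverses_def\<close>)

definition translate :: "'a \<Rightarrow> 'a set \<Rightarrow> 'a set" where
  "translate x Y = {g \<in> carrier G. g \<otimes> x \<in> Y}"

text \<open>Right translations are automorphisms as well: g s x = (g x)(x^-1 s x).\<close>

lemma card_edge_boundary_translate:
  assumes "Y \<subseteq> carrier G" "x \<in> carrier G"
  shows "card (edge_boundary (translate x Y)) \<le> card (edge_boundary Y)"
proof (rule card_inj_on_le[where f = "\<lambda>(g, s). (g \<otimes> x, inv x \<otimes> s \<otimes> x)"])
  show "inj_on (\<lambda>(g, s). (g \<otimes> x, inv x \<otimes> s \<otimes> x)) (edge_boundary (translate x Y))"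
    by (rule inj_on_inverseI[where g = "\<lambda>(g, s). (g \<otimes> inv x, x \<otimes> s \<otimes> inv x)"])
      (use assms in \<open>auto simp: edge_boundary_def translate_def m_assoc\<close>)
  show "(\<lambda>(g, s). (g \<otimes> x, inv x \<otimes> s \<otimes> x)) ` edge_boundary (translate x Y) \<subseteq> edge_boundary Y"
    using assms S_conj' by (auto simp: edge_boundary_def translate_def m_assoc)
qed (use assms in simp)

text \<open>Double counting: \<open>x\<close> and \<open>g\<close> with \<open>g\<close> and
  \<open>h = g \<otimes> x\<close> in \<open>Y\<close> are determined by the pair
  \<open>(g, h)\<close>.\<close>

lemma sum_card_inter_translate:
  assumes Y: "Y \<subseteq> carrier G"
  shows "(\<Sum>x\<in>carrier G. card (Y \<inter> translate x Y)) = (card Y)\<^sup>2"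
proof -
  have "(\<Sum>x\<in>carrier G. card (Y \<inter> translate x Y))
      = card (SIGMA x:carrier G. Y \<inter> translate x Y)"
    using Y finite_carrier by (subst card_SigmaI) auto
  also have "\<dots> = card (Y \<times> Y)"
    by (rule bij_betw_same_card[OF bij_betwI
          [where f = "\<lambda>(x, g). (g, g \<otimes> x)" and g = "\<lambda>(g, h). (inv g \<otimes> h, g)"]])
      (use Y in \<open>auto simp: translate_def subset_iff\<close>)
  finally show ?thesis by (simp add: card_cartesian_product power2_eq_square)
qed

text \<open>An element \<open>g\<close> lost in passing from \<open>x\<close> to
  \<open>x \<otimes> s\<close> yields the boundary edge \<open>(g \<otimes> x, s)\<close>, from
  which \<open>g\<close> is recovered.\<close>

lemma card_inter_translate_step:
  assumes Y: "Y \<subseteq> carrier G" and x: "x \<in> carrier G" and s: "s \<in> S"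
  shows "card (Y \<inter> translate x Y) \<le> card (Y \<inter> translate (x \<otimes> s) Y) + card (edge_boundary Y)"
proof -
  let ?D = "Y \<inter> translate x Y - Y \<inter> translate (x \<otimes> s) Y"
  have "card ?D \<le> card (edge_boundary Y)"
  proof (rule card_inj_on_le[where f = "\<lambda>g. (g \<otimes> x, s)"])
    show "inj_on (\<lambda>g. (g \<otimes> x, s)) ?D"
      by (rule inj_on_inverseI[where g = "\<lambda>(g, s). g \<otimes> inv x"]) (use Y x in auto)
    show "(\<lambda>g. (g \<otimes> x, s)) ` ?D \<subseteq> edge_boundary Y"
      using Y x s by (auto simp: edge_boundary_def translate_def m_assoc)
  qed (use Y in simp)
  moreover have "card (Y \<inter> translate x Y) \<le> card (Y \<inter> translate (x \<otimes> s) Y \<union> ?D)"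
    using Y by (intro card_mono) auto
  moreover have "\<dots> \<le> card (Y \<inter> translate (x \<otimes> s) Y) + card ?D" by (rule card_Un_le)
  ultimately show ?thesis by linarith
qed

section \<open>Rounding an eigenfunction to a sign function\<close>

definition level_sign :: "('a \<Rightarrow> real) \<Rightarrow> real \<Rightarrow> 'a \<Rightarrow> real" where
  "level_sign f t g = (if t \<le> (f g)\<^sup>2 then sgn (f g) else 0)"

definition support :: "('a \<Rightarrow> real) \<Rightarrow> 'a set" where
  "support \<chi> = {g \<in> carrier G. \<chi> g \<noteq> 0}"

text \<open>For nonzero \<sigma> this also contains every edge that leaves the support, so it bounds
  the edge boundary of the support.\<close>

definition mismatch :: "real \<Rightarrow> ('a \<Rightarrow> real) \<Rightarrow> ('a \<times> 'a) set" where
  "mismatch \<sigma> \<chi> = {(g, s). g \<in> carrier G \<and> s \<in> S \<and> \<chi> g \<noteq> 0 \<and> \<chi> (g \<otimes> s) \<noteq> \<sigma> * \<chi> g}"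

lemma support_subset: "support \<chi> \<subseteq> carrier G"
  by (auto simp: support_def)

lemma finite_mismatch [simp]: "finite (mismatch \<sigma> \<chi>)"
  by (rule finite_subset[where B = "carrier G \<times> S"])
    (auto simp: mismatch_def finite_carrier)

text \<open>Summing the pointwise inequality over all \<open>(g, s)\<close> and using the eigenvalue
  equation shows that the pairs of agreeing sign carry, through the smaller of their two squares, at
  least \<open>d * (1 - \<beta>)\<close> times the sum of all squares. Some level set then inherits
  this inequality as a count.\<close>

lemma exists_level_sign_mismatch:
  fixes f :: "'a \<Rightarrow> real" and \<sigma> l \<beta> :: real
  assumes \<sigma>: "\<sigma> = 1 \<or> \<sigma> = - 1" and \<beta>: "\<beta> > 0"
    and eigen: "\<And>g. g \<in> carrier G \<Longrightarrow> (\<Sum>s\<in>S. f (g \<otimes> s)) = l * f g"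
    and l: "card S * (1 - \<beta>\<^sup>2 / 2) \<le> \<sigma> * l"
    and nz: "\<exists>g\<in>carrier G. f g \<noteq> 0"
  shows "\<exists>t. support (level_sign f t) \<noteq> {} \<and>
    card (mismatch \<sigma> (level_sign f t)) \<le> card S * \<beta> * card (support (level_sign f t))"
proof -
  let ?V = "carrier G"
  define d where "d = real (card S)"
  define T where "T = (\<Sum>g\<in>?V. (f g)\<^sup>2)"
  define P where "P = {p \<in> ?V \<times> S. 0 < \<sigma> * f (fst p) * f (fst p \<otimes> snd p)}"
  define m where "m p = min ((f (fst p))\<^sup>2) ((f (fst p \<otimes> snd p))\<^sup>2)" for p
  have T_nonneg: "0 \<le> T" unfolding T_def by (intro sum_nonneg) simp
  have finP: "finite P" unfolding P_def using finite_carrier by simp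
  have sum1: "(\<Sum>g\<in>?V. \<Sum>s\<in>S. (f g)\<^sup>2) = d * T"
    by (simp add: T_def d_def sum_distrib_left)
  have "(\<Sum>g\<in>?V. \<Sum>s\<in>S. (f (g \<otimes> s))\<^sup>2) = (\<Sum>s\<in>S. \<Sum>g\<in>?V. (f (g \<otimes> s))\<^sup>2)"
    by (rule sum.swap)
  also have "\<dots> = (\<Sum>s\<in>S. T)"
    unfolding T_def by (intro sum.cong sum_right_mult[where h = "\<lambda>g. (f g)\<^sup>2"]) auto
  finally have sum2: "(\<Sum>g\<in>?V. \<Sum>s\<in>S. (f (g \<otimes> s))\<^sup>2) = d * T" by (simp add: d_def)
  have "(\<Sum>g\<in>?V. f g * (\<Sum>s\<in>S. f (g \<otimes> s))) = (\<Sum>g\<in>?V. f g * (l * f g))"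
    by (intro sum.cong refl) (simp add: eigen)
  also have "\<dots> = l * T"
    by (simp add: T_def sum_distrib_left power2_eq_square algebra_simps)
  finally have sum3: "(\<Sum>g\<in>?V. f g * (\<Sum>s\<in>S. f (g \<otimes> s))) = l * T" .
  have sumP: "(\<Sum>g\<in>?V. \<Sum>s\<in>S. if 0 < \<sigma> * f g * f (g \<otimes> s)
      then min ((f g)\<^sup>2) ((f (g \<otimes> s))\<^sup>2) else 0) = sum m P"
    unfolding P_def m_def using finite_carrier
    by (simp add: sum.inter_filter sum.cartesian_product case_prod_unfold)
  have "(\<Sum>g\<in>?V. \<Sum>s\<in>S. (f g)\<^sup>2 + (f (g \<otimes> s))\<^sup>2
        - 2 * (if 0 < \<sigma> * f g * f (g \<otimes> s) then min ((f g)\<^sup>2) ((f (g \<otimes> s))\<^sup>2) else 0))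
      \<le> (\<Sum>g\<in>?V. \<Sum>s\<in>S. (f (g \<otimes> s) - \<sigma> * f g)\<^sup>2 / \<beta> + \<beta> / 2 * ((f g)\<^sup>2 + (f (g \<otimes> s))\<^sup>2))"
    by (intro sum_mono diff_min_squares_le \<sigma> \<beta>)
  also have "(\<Sum>g\<in>?V. \<Sum>s\<in>S. (f g)\<^sup>2 + (f (g \<otimes> s))\<^sup>2
        - 2 * (if 0 < \<sigma> * f g * f (g \<otimes> s) then min ((f g)\<^sup>2) ((f (g \<otimes> s))\<^sup>2) else 0))
      = 2 * d * T - 2 * sum m P"
    by (simp only: sum_subtractf sum.distrib sum_distrib_left[symmetric] sum1 sum2 sumP)
  also have "(\<Sum>g\<in>?V. \<Sum>s\<in>S. (f (g \<otimes> s) - \<sigma> * f g)\<^sup>2 / \<beta> + \<beta> / 2 * ((f g)\<^sup>2 + (f (g \<otimes> s))\<^sup>2))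
      = (\<Sum>g\<in>?V. \<Sum>s\<in>S. 1 / \<beta> * ((f (g \<otimes> s))\<^sup>2 + (f g)\<^sup>2 - (2 * \<sigma>) * (f g * f (g \<otimes> s)))
          + \<beta> / 2 * ((f g)\<^sup>2 + (f (g \<otimes> s))\<^sup>2))"
    using \<sigma> by (intro sum.cong refl) (auto simp: power2_diff power2_sum algebra_simps add_divide_distrib diff_divide_distrib)
  also have "\<dots> = 1 / \<beta> * (2 * d * T - 2 * \<sigma> * (l * T)) + \<beta> / 2 * (2 * d * T)"
    by (simp only: sum_subtractf sum.distrib sum_distrib_left[symmetric] sum1 sum2 sum3) simp
  \<comment> \<open>The bound on \<open>l\<close> makes the sum of squared differences at most
    \<open>d * \<beta>\<^sup>2 * T\<close>, so both terms become \<open>d * \<beta> * T\<close>;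
    this balance dictates the form of the eigenvalue gap.\<close>
  also have "\<dots> \<le> 1 / \<beta> * (d * \<beta>\<^sup>2 * T) + \<beta> / 2 * (2 * d * T)"
  proof -
    have "(2 * d - 2 * (\<sigma> * l)) * T \<le> (d * \<beta>\<^sup>2) * T"
      using l T_nonneg by (intro mult_right_mono) (auto simp: d_def algebra_simps)
    then have "2 * d * T - 2 * \<sigma> * (l * T) \<le> d * \<beta>\<^sup>2 * T" by (simp add: algebra_simps)
    then show ?thesis using \<beta> by (intro add_right_mono mult_left_mono) auto
  qed
  also have "\<dots> = 2 * (d * \<beta> * T)" using \<beta> by (simp add: power2_eq_square)
  finally have main: "d * (1 - \<beta>) * T - sum m P \<le> 0" by (simp add: algebra_simps)

  \<comment> \<open>Vertices and agreeing pairs share one index set, so that a single level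
    \<open>t\<close> serves both. The weights \<open>c\<close> turn \<open>main\<close> into the
    hypothesis of the threshold lemma.\<close>
  define v where "v = case_sum (\<lambda>g. (f g)\<^sup>2) m"
  define c where "c = case_sum (\<lambda>g :: 'a. d * (1 - \<beta>)) (\<lambda>p :: 'a \<times> 'a. - 1)"
  have "\<exists>t>0. (\<exists>i\<in>?V <+> P. t \<le> v i) \<and> sum c {i \<in> ?V <+> P. t \<le> v i} \<le> 0"
  proof (rule threshold_sum_nonpos)
    show "finite (?V <+> P)" using finite_carrier finP by simp
    show "0 \<le> v i" if "i \<in> ?V <+> P" for i
      by (cases i) (auto simp: v_def m_def)
    show "\<exists>i\<in>?V <+> P. 0 < v i" using nz by (force simp: v_def)
    have "(\<Sum>i\<in>?V <+> P. c i * v i) = d * (1 - \<beta>) * T - sum m P"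
      using finite_carrier finP
      by (simp add: sum.Plus c_def v_def T_def sum_distrib_left sum_negf)
    then show "(\<Sum>i\<in>?V <+> P. c i * v i) \<le> 0" using main by simp
  qed
  then obtain t i where t: "t > 0" "i \<in> ?V <+> P" "t \<le> v i"
    and le: "sum c {i \<in> ?V <+> P. t \<le> v i} \<le> 0" by blast
  define \<chi> where "\<chi> = level_sign f t"
  define U where "U = support \<chi>"
  define Q where "Q = {p \<in> P. t \<le> m p}"
  have U_eq: "U = {g \<in> ?V. t \<le> (f g)\<^sup>2}"
    using t(1) by (auto simp: U_def support_def \<chi>_def level_sign_def sgn_zero_iff)
  have finU: "finite U" using finite_carrier by (simp add: U_eq)
  have "{i \<in> ?V <+> P. t \<le> v i} = U <+> Q"
    by (auto simp: U_eq Q_def v_def)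
  then have "sum c (U <+> Q) \<le> 0" using le by simp
  then have le': "d * (1 - \<beta>) * card U \<le> card Q"
    using finU finP by (simp add: sum.Plus c_def Q_def algebra_simps)
  have "U \<noteq> {}" using t(2,3) by (auto simp: U_eq v_def m_def P_def)
  have Q_sub: "Q \<subseteq> U \<times> S" by (auto simp: Q_def P_def U_eq m_def)
  \<comment> \<open>A pair in \<open>Q\<close> has both ends above the level and the right relative
    sign, so it is no mismatch; by \<open>le'\<close> at most \<open>d * \<beta> * card U\<close>
    pairs remain.\<close>
  have "mismatch \<sigma> \<chi> \<subseteq> U \<times> S - Q"
  proof -
    have "\<chi> (g \<otimes> s) = \<sigma> * \<chi> g" if "(g, s) \<in> Q" for g s
    proof -
      have "0 < \<sigma> * f g * f (g \<otimes> s)" "t \<le> (f g)\<^sup>2" "t \<le> (f (g \<otimes> s))\<^sup>2"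
        using that by (auto simp: Q_def P_def m_def)
      moreover from this(1) have "sgn (f (g \<otimes> s)) = \<sigma> * sgn (f g)"
        using \<sigma> by (auto simp: zero_less_mult_iff mult_less_0_iff)
      ultimately show ?thesis by (simp add: \<chi>_def level_sign_def)
    qed
    then show ?thesis by (auto simp: mismatch_def U_def support_def)
  qed
  then have "card (mismatch \<sigma> \<chi>) \<le> card (U \<times> S - Q)"
    using finU by (intro card_mono) auto
  then have "card (mismatch \<sigma> \<chi>) \<le> card U * card S - card Q"
    using Q_sub finU finP by (simp add: card_Diff_subset card_cartesian_product Q_def)
  moreover have "card Q \<le> card U * card S"
    using card_mono[OF _ Q_sub] finU by (simp add: card_cartesian_product)
  ultimately have "card (mismatch \<sigma> \<chi>) + card Q \<le> card U * card S" by linarith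
  then have "real (card (mismatch \<sigma> \<chi>)) + card Q \<le> card U * d"
    unfolding d_def by (metis of_nat_add of_nat_le_iff of_nat_mult)
  then have "card (mismatch \<sigma> \<chi>) \<le> d * \<beta> * card U" using le' by (simp add: algebra_simps)
  then show ?thesis using \<open>U \<noteq> {}\<close> unfolding U_def \<chi>_def d_def by blast
qed

end

section \<open>Sizes of sets with small edge boundary\<close>

locale expanding_sum_graph = normal_generating_set +
  fixes \<epsilon> :: real
  assumes eps_pos: "0 < \<epsilon>" and expander: "cayley_sum_vertex_expander G S \<epsilon>"
begin

abbreviation n :: real where "n \<equiv> real (card (carrier G))"

lemma n_pos: "0 < n"
  using finite_carrier by (simp add: card_gt_0_iff) blast

text \<open>If Y = Y^-1, then Y^-1 S = Y S, so each new neighbour in the sum graph is the end of a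
  Cayley edge that leaves \<open>Y\<close>.\<close>

lemma symmetric_small_boundary:
  assumes Y: "Y \<subseteq> carrier G" and sym: "inverses Y = Y" and half: "real (card Y) \<le> n / 2"
  shows "\<epsilon> * card Y \<le> card (edge_boundary Y)"
proof (cases "Y = {}")
  case False
  have inv_Y: "inv g \<in> Y" if "g \<in> Y" for g using that sym by (auto simp: inverses_def)
  have "(set_inv Y <#> S) - Y \<subseteq> (\<lambda>(g, s). g \<otimes> s) ` edge_boundary Y"
  proof
    fix x assume x: "x \<in> (set_inv Y <#> S) - Y"
    then obtain g s where "g \<in> Y" "s \<in> S" "x = inv g \<otimes> s"
      by (auto simp: SET_INV_def set_mult_def)
    then have "(inv g, s) \<in> edge_boundary Y" using x inv_Y by (auto simp: edge_boundary_def)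
    then show "x \<in> (\<lambda>(g, s). g \<otimes> s) ` edge_boundary Y"
      using \<open>x = inv g \<otimes> s\<close> by (force intro: image_eqI)
  qed
  then have "card ((set_inv Y <#> S) - Y) \<le> card ((\<lambda>(g, s). g \<otimes> s) ` edge_boundary Y)"
    using Y by (intro card_mono) auto
  also have "\<dots> \<le> card (edge_boundary Y)" using Y by (intro card_image_le) simp
  finally have "real (card ((set_inv Y <#> S) - Y)) \<le> card (edge_boundary Y)" by simp
  moreover have "\<epsilon> * card Y \<le> card ((set_inv Y <#> S) - Y)"
    using expander Y False half by (auto simp: cayley_sum_vertex_expander_def)
  ultimately show ?thesis by linarith
qed simp

lemma card_compl_real: "Y \<subseteq> carrier G \<Longrightarrow> real (card (carrier G - Y)) = n - card Y"
  using finite_carrier by (simp add: card_Diff_subset of_nat_diff card_mono)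

lemma symmetric_dichotomy:
  fixes a :: real
  assumes Y: "Y \<subseteq> carrier G" and sym: "inverses Y = Y" and b: "card (edge_boundary Y) \<le> \<epsilon> * a"
  shows "card Y \<le> a \<or> n - card Y \<le> a"
proof (cases "real (card Y) \<le> n / 2")
  case True
  then have "\<epsilon> * card Y \<le> \<epsilon> * a" using symmetric_small_boundary[OF Y sym] b by linarith
  then show ?thesis using eps_pos by simp
next
  case False
  have "\<epsilon> * card (carrier G - Y) \<le> card (edge_boundary (carrier G - Y))"
  proof (rule symmetric_small_boundary)
    show "inverses (carrier G - Y) = carrier G - Y"
      using sym Y by (auto simp: inverses_def)
  qed (use False card_compl_real[OF Y] in auto)
  also have "\<dots> \<le> card (edge_boundary Y)" using card_edge_boundary_compl[OF Y] by simp
  finally have "\<epsilon> * card (carrier G - Y) \<le> \<epsilon> * a" using b by linarith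
  then show ?thesis using eps_pos card_compl_real[OF Y] by simp
qed

text \<open>The intersection and the union of \<open>Y\<close> and its inverse are symmetric with at
  most twice the boundary, and their sizes add up to 2 |Y|. If the intersection is small and the
  union almost everything, then 2 |Y| lies within \<open>a\<close> of \<open>n\<close>.\<close>

lemma boundary_trichotomy:
  fixes a :: real
  assumes Y: "Y \<subseteq> carrier G" and b: "2 * real (card (edge_boundary Y)) \<le> \<epsilon> * a"
  shows "card Y \<le> a \<or> n - card Y \<le> a \<or> \<bar>card Y - n / 2\<bar> \<le> a / 2"
proof -
  have I: "inverses Y \<subseteq> carrier G" by (auto simp: inverses_def)
  have bI: "card (edge_boundary (inverses Y)) \<le> card (edge_boundary Y)"
    by (rule card_edge_boundary_inverses[OF Y])
  have cap: "card (Y \<inter> inverses Y) \<le> a \<or> n - card (Y \<inter> inverses Y) \<le> a"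
  proof (rule symmetric_dichotomy)
    show "real (card (edge_boundary (Y \<inter> inverses Y))) \<le> \<epsilon> * a"
      using card_edge_boundary_inter[OF Y I] bI b by linarith
  qed (use Y in \<open>auto simp: inverses_def\<close>)
  have cup: "card (Y \<union> inverses Y) \<le> a \<or> n - card (Y \<union> inverses Y) \<le> a"
  proof (rule symmetric_dichotomy)
    show "real (card (edge_boundary (Y \<union> inverses Y))) \<le> \<epsilon> * a"
      using card_edge_boundary_union[OF Y I] bI b by linarith
  qed (use Y in \<open>auto simp: inverses_def\<close>)
  have "card (Y \<inter> inverses Y) \<le> card Y" "card Y \<le> card (Y \<union> inverses Y)"
      "card (Y \<union> inverses Y) \<le> card (carrier G)"
    using Y I finite_carrier by (auto intro!: card_mono)
  moreover have "card Y + card Y = card (Y \<union> inverses Y) + card (Y \<inter> inverses Y)"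
    using card_Un_Int[of Y "inverses Y"] Y I by (simp add: card_inverses)
  then have "real (card Y) + card Y = real (card (Y \<union> inverses Y)) + card (Y \<inter> inverses Y)"
    by (metis of_nat_add)
  ultimately show ?thesis using cap cup by linarith
qed

lemma boundary_dichotomy:
  fixes a :: real
  assumes Y: "Y \<subseteq> carrier G" and b: "2 * real (card (edge_boundary Y)) \<le> \<epsilon> * a"
    and a: "a \<le> n / 8" and small: "card (edge_boundary Y) \<le> n / 16"
  shows "card Y \<le> a \<or> n - card Y \<le> a"
proof (rule ccontr)
  assume *: "\<not> ?thesis"
  then have mid: "\<bar>card Y - n / 2\<bar> \<le> a / 2" using boundary_trichotomy[OF Y b] by auto
  have "0 \<le> \<epsilon> * a" using b by linarith
  then have a0: "0 \<le> a" using eps_pos by (simp add: zero_le_mult_iff)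
  define c where "c x = card (Y \<inter> translate x Y)" for x
  \<comment> \<open>The intersection has at most twice the boundary, so the trichotomy applies with
    \<open>2 * a\<close>. Its last two cases both give the lower bound.\<close>
  have gap: "c x \<le> 2 * a \<or> n / 2 - a \<le> c x" if x: "x \<in> carrier G" for x
  proof -
    have T: "translate x Y \<subseteq> carrier G" by (auto simp: translate_def)
    have "2 * real (card (edge_boundary (Y \<inter> translate x Y))) \<le> \<epsilon> * (2 * a)"
      using card_edge_boundary_inter[OF Y T] card_edge_boundary_translate[OF Y x] b by linarith
    then have "c x \<le> 2 * a \<or> n - c x \<le> 2 * a \<or> \<bar>c x - n / 2\<bar> \<le> 2 * a / 2"
      unfolding c_def using Y by (intro boundary_trichotomy) auto
    moreover have "c x \<le> card Y" unfolding c_def using Y by (intro card_mono) auto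
    ultimately show ?thesis using mid a n_pos by linarith
  qed
  \<comment> \<open>The forbidden interval runs from at most n/4 to at least 3n/8, and one generator
    lowers \<open>c\<close> by at most n/16, so the interval cannot be crossed.\<close>
  have big: "n / 2 - a \<le> c x" if "x \<in> carrier G" for x
  proof (rule generate_right_induct[OF that, where Q = "\<lambda>x. n / 2 - a \<le> c x"])
    have "Y \<inter> translate \<one> Y = Y" using Y by (auto simp: translate_def)
    then have "c \<one> = card Y" by (simp add: c_def)
    then show "n / 2 - a \<le> c \<one>" using mid a0 by linarith
  next
    fix z s assume z: "z \<in> carrier G" and s: "s \<in> S" and IH: "n / 2 - a \<le> c z"
    have "c z \<le> c (z \<otimes> s) + card (edge_boundary Y)"
      unfolding c_def by (rule card_inter_translate_step[OF Y z s])
    then have "real (c z) \<le> c (z \<otimes> s) + card (edge_boundary Y)" by linarith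
    then show "n / 2 - a \<le> c (z \<otimes> s)" using gap[of "z \<otimes> s"] z s IH a small n_pos by auto
  qed
  \<comment> \<open>The average of \<open>c\<close> would be at least 3n/8 = 96n/256, but it is
    |Y|^2 / n, at most 81n/256.\<close>
  have "n * (n / 2 - a) \<le> (\<Sum>x\<in>carrier G. real (c x))"
    using sum_bounded_below[of "carrier G" "n / 2 - a" "\<lambda>x. real (c x)"] big by simp
  also have "\<dots> = real ((card Y)\<^sup>2)"
    unfolding c_def by (simp only: sum_card_inter_translate[OF Y] of_nat_sum[symmetric])
  also have "\<dots> \<le> (n / 2 + a / 2)\<^sup>2"
  proof -
    have "real (card Y) \<le> n / 2 + a / 2" using mid by linarith
    then show ?thesis by (simp add: power_mono del: power_divide)
  qed
  also have "\<dots> \<le> (n / 2 + n / 16)\<^sup>2" using a a0 by (intro power_mono) auto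
  finally have "n * (n / 2 - a) \<le> (9 * n / 16)\<^sup>2" by simp
  moreover have "n * (n * (3 / 8)) \<le> n * (n / 2 - a)" using a n_pos by (intro mult_left_mono) auto
  moreover have "(9 * n / 16)\<^sup>2 < n * (n * (3 / 8))" using n_pos by (simp add: power2_eq_square)
  ultimately show False by linarith
qed

section \<open>Consequences of a sign function with few mismatches\<close>

lemma card_support_pos: "support \<chi> \<noteq> {} \<Longrightarrow> 0 < card (support \<chi>)"
  using support_subset finite_sub by (simp add: card_gt_0_iff)

lemma card_support_le: "real (card (support \<chi>)) \<le> n"
  using card_mono[OF finite_carrier support_subset] by simp

text \<open>The positive part and its inverse split the support into equal halves. The positive part
  thus has at most n/2 elements, and its boundary is too small for a set that is neither empty nor
  almost all of the group.\<close>

lemma odd_sign_mismatch: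
  assumes odd: "\<And>g. g \<in> carrier G \<Longrightarrow> \<chi> (inv g) = - \<chi> g"
    and ne: "support \<chi> \<noteq> {}"
    and E1: "64 * real (card (mismatch 1 \<chi>)) \<le> \<epsilon> * card (support \<chi>)"
    and E2: "32 * card (mismatch 1 \<chi>) \<le> card (support \<chi>)"
  shows False
proof -
  define Y where "Y = {g \<in> carrier G. 0 < \<chi> g}"
  have Y: "Y \<subseteq> carrier G" by (auto simp: Y_def)
  have "support \<chi> = Y \<union> inverses Y"
    using odd by (auto simp: support_def Y_def inverses_def)
  moreover have "Y \<inter> inverses Y = {}" using odd by (auto simp: Y_def inverses_def)
  moreover have "inverses Y \<subseteq> carrier G" by (auto simp: inverses_def)
  ultimately have U: "card (support \<chi>) = 2 * card Y"
    using Y by (simp add: card_Un_disjoint card_inverses)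
  have pos: "0 < card Y" using card_support_pos[OF ne] U by simp
  have "edge_boundary Y \<subseteq> mismatch 1 \<chi>"
    by (auto simp: edge_boundary_def mismatch_def Y_def)
  then have "card (edge_boundary Y) \<le> card (mismatch 1 \<chi>)" by (intro card_mono) auto
  then have "card Y \<le> card Y / 16 \<or> n - card Y \<le> card Y / 16"
    using E1 E2 U card_support_le[of \<chi>]
    by (intro boundary_dichotomy[OF Y]) (auto simp: algebra_simps)
  then show False using pos card_support_le[of \<chi>] U by auto
qed

text \<open>Since \<chi> changes sign along most edges, multiplying \<open>x\<close> by a generator
  exchanges the two cases \<open>Z x\<close> tiny and \<open>Z x\<close> almost everything.\<close>

lemma alternating_sign_bipartite:
  assumes vals: "\<And>g. \<chi> g \<in> {- 1, 0, 1}"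
    and ne: "support \<chi> \<noteq> {}"
    and E1: "64 * real (card (mismatch (- 1) \<chi>)) \<le> \<epsilon> * card (support \<chi>)"
    and E2: "32 * card (mismatch (- 1) \<chi>) \<le> card (support \<chi>)"
  shows "bipartite (carrier G) (cayley_sum_adj G S)"
proof -
  let ?V = "carrier G" and ?N = "mismatch (- 1) \<chi>"
  define U where "U = support \<chi>"
  have U: "U \<subseteq> ?V" "0 < card U" "real (card U) \<le> n"
    using ne support_subset card_support_pos card_support_le by (auto simp: U_def)
  have "edge_boundary U \<subseteq> ?N"
    by (auto simp: edge_boundary_def mismatch_def U_def support_def)
  then have "card (edge_boundary U) \<le> card ?N" by (intro card_mono) auto
  then have "card U \<le> card U / 32 \<or> n - card U \<le> card U / 32"
    using E1 E2 U unfolding U_def[symmetric]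
    by (intro boundary_dichotomy[OF U(1)]) (auto simp: algebra_simps)
  then have W: "real (card (?V - U)) \<le> n / 32" using U card_compl_real[OF U(1)] by auto
  have N: "real (card ?N) \<le> n / 32" using E2 U unfolding U_def[symmetric] by linarith

  define Z where "Z x = {g \<in> ?V. \<chi> g \<noteq> 0 \<and> \<chi> (g \<otimes> x) = \<chi> g}" for x
  have Z_sub: "Z x \<subseteq> ?V" for x by (auto simp: Z_def)
  \<comment> \<open>An edge \<open>(g, s)\<close> that leaves \<open>Z x\<close> is a mismatch
    itself or its translate by \<open>x\<close> is one; otherwise both values flip and still
    agree.\<close>
  have bd_Z: "card (edge_boundary (Z x)) \<le> 2 * card ?N" if x: "x \<in> ?V" for x
  proof -
    let ?h = "\<lambda>(g, s). (g \<otimes> x, inv x \<otimes> s \<otimes> x)"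
    let ?M = "edge_boundary (Z x) - ?N"
    have "card ?M \<le> card ?N"
    proof (rule card_inj_on_le[where f = ?h])
      show "inj_on ?h ?M"
        by (rule inj_on_inverseI[where g = "\<lambda>(g, s). (g \<otimes> inv x, x \<otimes> s \<otimes> inv x)"])
          (use x in \<open>auto simp: edge_boundary_def Z_def m_assoc\<close>)
      show "?h ` ?M \<subseteq> ?N"
        using x S_conj' by (auto simp: edge_boundary_def mismatch_def Z_def m_assoc)
    qed simp
    moreover have "card (edge_boundary (Z x)) \<le> card (?N \<union> ?M)"
      using Z_sub by (intro card_mono) auto
    moreover have "\<dots> \<le> card ?N + card ?M" by (rule card_Un_le)
    ultimately show ?thesis by linarith
  qed
  have dich: "card (Z x) \<le> n / 16 \<or> n - card (Z x) \<le> n / 16" if x: "x \<in> ?V" for x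
  proof (rule boundary_dichotomy[OF Z_sub])
    have "\<epsilon> * card U \<le> \<epsilon> * n" using U eps_pos by simp
    then show "2 * real (card (edge_boundary (Z x))) \<le> \<epsilon> * (n / 16)"
      using bd_Z[OF x] E1 unfolding U_def[symmetric] by (simp add: algebra_simps)
    show "real (card (edge_boundary (Z x))) \<le> n / 16" using bd_Z[OF x] N by linarith
  qed (use n_pos in simp)

  define B where "B x s = {g \<in> ?V. (g \<otimes> x, s) \<in> ?N}" for x s
  have B: "card (B x s) \<le> card ?N" if x: "x \<in> ?V" for x s
  proof (rule card_inj_on_le[where f = "\<lambda>g. (g \<otimes> x, s)"])
    show "inj_on (\<lambda>g. (g \<otimes> x, s)) (B x s)"
      by (rule inj_on_inverseI[where g = "\<lambda>(g, s). g \<otimes> inv x"]) (use x in \<open>auto simp: B_def\<close>)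
  qed (auto simp: B_def)
  have to_large: "n < card (Z (x \<otimes> s)) + n / 4"
    if x: "x \<in> ?V" and s: "s \<in> S" and small: "card (Z x) \<le> n / 16" for x s
  proof -
    let ?W' = "{g \<in> ?V. g \<otimes> x \<in> ?V - U}"
    \<comment> \<open>Off the last four sets, the values at \<open>g\<close> and
      \<open>g \<otimes> x\<close> are nonzero and, by \<open>vals\<close>, opposite; the flip along
      \<open>s\<close> restores agreement. These four sets have at most 5n/32 elements
      together.\<close>
    have "?V \<subseteq> Z (x \<otimes> s) \<union> (?V - U) \<union> ?W' \<union> Z x \<union> B x s"
    proof
      fix g assume g: "g \<in> ?V"
      show "g \<in> Z (x \<otimes> s) \<union> (?V - U) \<union> ?W' \<union> Z x \<union> B x s"
        using g x s vals[of g] vals[of "g \<otimes> x"]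
        by (auto simp: Z_def B_def U_def support_def mismatch_def m_assoc)
    qed
    then have "card ?V \<le> card (Z (x \<otimes> s) \<union> (?V - U) \<union> ?W' \<union> Z x \<union> B x s)"
      using Z_sub by (intro card_mono) (auto simp: B_def finite_carrier)
    also have "\<dots> \<le> card (Z (x \<otimes> s)) + card (?V - U) + card ?W' + card (Z x) + card (B x s)"
      by (meson add_mono_thms_linordered_semiring(3) card_Un_le order_trans)
    also have "card ?W' = card (?V - U)"
      using card_right_mult[OF x, of "\<lambda>g. g \<in> ?V - U"] by (simp add: set_diff_eq)
    finally show ?thesis using W B[OF x, of s] N small n_pos by linarith
  qed
  have to_small: "card (Z (x \<otimes> s)) \<le> n / 4"
    if x: "x \<in> ?V" and s: "s \<in> S" and large: "n - card (Z x) \<le> n / 16" for x s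
  proof -
    \<comment> \<open>On \<open>Z x\<close> a flip along \<open>s\<close> destroys the agreement.
      The right side has at most 3n/32 elements.\<close>
    have "Z (x \<otimes> s) \<subseteq> (?V - Z x) \<union> B x s"
      using x s by (auto simp: Z_def B_def mismatch_def m_assoc)
    then have "card (Z (x \<otimes> s)) \<le> card ((?V - Z x) \<union> B x s)"
      by (intro card_mono) (auto simp: B_def finite_carrier)
    also have "\<dots> \<le> card (?V - Z x) + card (B x s)" by (rule card_Un_le)
    finally show ?thesis using B[OF x, of s] N large card_compl_real[OF Z_sub, of x] n_pos by linarith
  qed
  have Z_inv: "card (Z (inv x)) = card (Z x)" if x: "x \<in> ?V" for x
    by (rule bij_betw_same_card[OF bij_betwI
          [where f = "\<lambda>g. g \<otimes> inv x" and g = "\<lambda>g. g \<otimes> x"]])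
      (use x in \<open>auto simp: Z_def\<close>)

  define K where "K = {x \<in> ?V. n / 2 < card (Z x)}"
  have flip: "x \<otimes> s \<in> K \<longleftrightarrow> x \<notin> K" if "x \<in> ?V" "s \<in> S" for x s
    using dich[OF that(1)] to_large[OF that] to_small[OF that] that n_pos
    by (auto simp: K_def)
  \<comment> \<open>\<open>K\<close> is closed under inversion by \<open>Z_inv\<close>, so the flip
    along Cayley edges carries over to the edges \<open>h = inv g \<otimes> s\<close> of the sum
    graph.\<close>
  have edge: "h \<in> K \<longleftrightarrow> g \<notin> K" if "cayley_sum_adj G S g h" for g h
  proof -
    have gh: "g \<in> ?V" "h \<in> ?V" "g \<otimes> h \<in> S" using that by (auto simp: cayley_sum_adj_def)
    then have "h = inv g \<otimes> (g \<otimes> h)" by simp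
    moreover have "inv g \<in> K \<longleftrightarrow> g \<in> K" using gh Z_inv by (simp add: K_def)
    ultimately show ?thesis using flip[of "inv g" "g \<otimes> h"] gh by simp
  qed
  show ?thesis unfolding bipartite_def
    by (intro exI[of _ K] exI[of _ "?V - K"]) (use edge in \<open>auto simp: K_def\<close>)
qed

end

section \<open>From matrix eigenvalues to functions on the group, and the final argument\<close>

lemma (in normal_generating_set) eigenvalue_imp_eigenfunction:
  fixes \<mu> :: real
  assumes gs: "distinct gs" "set gs = carrier G" and S: "S \<noteq> {}"
    and ev: "eigenvalue (cayley_sum_normalised_adj_matrix G S gs) \<mu>"
  obtains f :: "'a \<Rightarrow> real" where "\<exists>g\<in>carrier G. f g \<noteq> 0"
    and "\<And>g. g \<in> carrier G \<Longrightarrow> (\<Sum>s\<in>S. f (inv g \<otimes> s)) = card S * \<mu> * f g"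
proof -
  let ?M = "cayley_sum_normalised_adj_matrix G S gs" and ?k = "length gs"
  have M: "?M \<in> carrier_mat ?k ?k"
    by (simp add: cayley_sum_normalised_adj_matrix_def cayley_sum_adj_matrix_def)
  from ev obtain v where v: "v \<in> carrier_vec ?k" "v \<noteq> 0\<^sub>v ?k" "?M *\<^sub>v v = \<mu> \<cdot>\<^sub>v v"
    using M by (auto simp: eigenvalue_def eigenvector_def)
  have bij: "bij_betw ((!) gs) {..<?k} (carrier G)"
    using bij_betw_nth[OF gs(1) refl refl] gs(2) by simp
  define f where "f g = v $ the_inv_into {..<?k} ((!) gs) g" for g
  have f_nth: "f (gs ! i) = v $ i" if "i < ?k" for i
    using bij that by (simp add: f_def the_inv_into_f_f bij_betw_def)
  have nz: "\<exists>g\<in>carrier G. f g \<noteq> 0"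
  proof (rule ccontr)
    assume "\<not> ?thesis"
    then have "v $ i = 0" if "i < ?k" for i using f_nth[OF that] gs(2) that nth_mem by metis
    then have "v = 0\<^sub>v ?k" using v(1) by (intro eq_vecI) auto
    then show False using v(2) by simp
  qed
  have "(\<Sum>s\<in>S. f (inv g \<otimes> s)) = card S * \<mu> * f g" if g: "g \<in> carrier G" for g
  proof -
    obtain i where i: "i < ?k" "g = gs ! i" using g gs(2) by (metis in_set_conv_nth)
    have "\<mu> * f g = (?M *\<^sub>v v) $ i" using v i f_nth by simp
    also have "\<dots> = (\<Sum>j<?k. 1 / card S * (if g \<otimes> gs ! j \<in> S then f (gs ! j) else 0))"
      using v(1) i M
      by (auto simp: scalar_prod_def f_nth cayley_sum_normalised_adj_matrix_def
          cayley_sum_adj_matrix_def atLeast0LessThan intro!: sum.cong)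
    also have "\<dots> = 1 / card S * (\<Sum>j<?k. if g \<otimes> gs ! j \<in> S then f (gs ! j) else 0)"
      by (simp only: sum_distrib_left)
    also have "(\<Sum>j<?k. if g \<otimes> gs ! j \<in> S then f (gs ! j) else 0)
        = (\<Sum>h\<in>carrier G. if g \<otimes> h \<in> S then f h else 0)"
      by (rule sum.reindex_bij_betw[OF bij, where g = "\<lambda>h. if g \<otimes> h \<in> S then f h else 0"])
    also have "\<dots> = (\<Sum>h\<in>{h \<in> carrier G. g \<otimes> h \<in> S}. f h)"
      using finite_carrier by (simp add: sum.inter_filter)
    also have "\<dots> = (\<Sum>s\<in>S. f (inv g \<otimes> s))"
      by (rule sum.reindex_bij_witness[where i = "\<lambda>s. inv g \<otimes> s" and j = "\<lambda>h. g \<otimes> h"])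
        (use g in auto)
    finally show ?thesis using S by (simp add: field_simps)
  qed
  then show ?thesis using that nz by blast
qed

text \<open>The Cayley operator commutes with inversion, since s -> g s^-1 g^-1 permutes
  \<open>S\<close>.\<close>

lemma (in normal_generating_set) sum_S_inverse_conj:
  assumes g: "g \<in> carrier G"
  shows "(\<Sum>s\<in>S. f (inv (g \<otimes> s))) = (\<Sum>s\<in>S. f (inv g \<otimes> s))"
  by (rule sum.reindex_bij_witness[where i = "\<lambda>s. inv g \<otimes> inv s \<otimes> g" and j = "\<lambda>s. g \<otimes> inv s \<otimes> inv g"])
    (use g S_conj S_conj' S_inv in \<open>auto simp: inv_mult_group m_assoc\<close>)

text \<open>This provides \<open>2 \<le> d\<close> for the estimates in the theorem. If S = {s},
  then s^2 = 1 and the group is {1, s}; an empty \<open>S\<close> gives no edges.\<close>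

lemma (in normal_generating_set) bipartite_if_card_le_1:
  assumes "\<one> \<notin> S" "card S \<le> 1"
  shows "bipartite (carrier G) (cayley_sum_adj G S)"
proof -
  have flip: "x \<otimes> y \<notin> S \<or> (x = \<one>) \<noteq> (y = \<one>)" if xy: "x \<in> carrier G" "y \<in> carrier G" for x y
  proof (rule ccontr)
    assume "\<not> ?thesis"
    then have *: "x \<otimes> y \<in> S" "(x = \<one>) = (y = \<one>)" by auto
    then have "card S = 1" using assms(2) finite_S by (metis card_0_eq empty_iff le_SucE le_zero_eq One_nat_def)
    then obtain s where s: "S = {s}" by (auto simp: card_1_singleton_iff)
    then have "inv s = s" using S_inv by auto
    then have ss: "s \<otimes> s = \<one>" using s S_closed by (metis insertI1 r_inv)
    have "z = \<one> \<or> z = s" if "z \<in> carrier G" for z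
      using that by (rule generate_right_induct) (use s ss in auto)
    then consider "x = \<one>" "y = \<one>" | "x = s" "y = s" using * xy by metis
    then show False using * ss assms(1) by cases simp_all
  qed
  have "\<not> cayley_sum_adj G S x y" if "(x = \<one>) = (y = \<one>)" for x y
    using flip that by (auto simp: cayley_sum_adj_def)
  then show ?thesis unfolding bipartite_def
    by (intro exI[of _ "{\<one>}"] exI[of _ "carrier G - {\<one>}"]) auto
qed

theorem theorem2p10:
  fixes G :: "('a, 'b) monoid_scheme" (structure)
    and S :: "'a set" and d :: nat and \<epsilon> :: real and gs :: "'a list" and \<mu> :: real
  assumes "group G"
    and "finite (carrier G)"
    and "S \<subseteq> carrier G"
    and "set_inv S = S"
    and "generate G S = carrier G"
    and "\<one> \<notin> S"
    and "\<And>g s. g \<in> carrier G \<Longrightarrow> s \<in> S \<Longrightarrow> g \<otimes> s \<otimes> inv g \<in> S"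
    and "card S = d"
    and "\<epsilon> > 0"
    and "cayley_sum_vertex_expander G S \<epsilon>"
    and "\<not> bipartite (carrier G) (cayley_sum_adj G S)"
    and "distinct gs" and "set gs = carrier G"
    and "eigenvalue (cayley_sum_normalised_adj_matrix G S gs) \<mu>"
  shows "\<mu> > - 1 + \<epsilon> ^ 4 / (2 ^ 9 * real d ^ 8)"
proof (rule ccontr)
  assume "\<not> ?thesis"
  then have \<mu>: "\<mu> \<le> - 1 + \<epsilon> ^ 4 / (2 ^ 9 * real d ^ 8)" by simp
  interpret group G by fact
  interpret normal_generating_set G S
  proof
    show "inv s \<in> S" if "s \<in> S" for s
      using that assms(4) by (auto simp: SET_INV_def)
  qed (use assms in auto)
  interpret expanding_sum_graph G S \<epsilon> by unfold_locales (use assms in auto)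
  have d2: "2 \<le> d" using bipartite_if_card_le_1 assms(6,8,11) by linarith
  have S_ne: "S \<noteq> {}" using d2 assms(8) by auto
  \<comment> \<open>Expansion is tested on the identity alone, which is at most half of a group with
    at least d + 1 elements.\<close>
  have eps_le: "\<epsilon> \<le> d"
  proof -
    have "card (insert \<one> S) \<le> card (carrier G)"
      using finite_carrier S_subset by (intro card_mono) auto
    then have "\<epsilon> * card {\<one>} \<le> card (edge_boundary {\<one>})"
      using assms(6,8) d2
      by (intro symmetric_small_boundary) (auto simp: inverses_def)
    also have "card (edge_boundary {\<one>}) \<le> card ({\<one>} \<times> S)"
      by (intro card_mono) (auto simp: edge_boundary_def)
    finally show ?thesis using assms(8) by (simp add: card_cartesian_product)
  qed
  define \<beta> where "\<beta> = \<epsilon>\<^sup>2 / (16 * real d ^ 4)"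
  have \<beta>_pos: "0 < \<beta>" using eps_pos d2 by (simp add: \<beta>_def)
  have \<beta>_sq: "\<beta>\<^sup>2 / 2 = \<epsilon> ^ 4 / (2 ^ 9 * real d ^ 8)"
    by (simp add: \<beta>_def power_divide power_mult_distrib power_mult[symmetric])
  \<comment> \<open>These are the mismatch bounds \<open>E1\<close> and \<open>E2\<close> of the two
    sign lemmas. They amount to 4 \<epsilon> \<le> d^3 and 2 \<epsilon>^2 \<le> d^3, which follow
    from \<epsilon> \<le> d and 2 \<le> d.\<close>
  have d\<beta>: "64 * (d * \<beta>) \<le> \<epsilon>" "32 * (d * \<beta>) \<le> 1"
  proof -
    have dd: "4 \<le> real d ^ 2" using power_mono[of 2 "real d" 2] d2 by simp
    have eq: "d * \<beta> = \<epsilon>\<^sup>2 / (16 * real d ^ 3)"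
      using d2 by (simp add: \<beta>_def field_simps power_numeral_reduce)
    have "4 * \<epsilon> \<le> real d ^ 2 * real d" using dd eps_le eps_pos by (intro mult_mono) auto
    then have "\<epsilon> * (4 * \<epsilon>) \<le> \<epsilon> * real d ^ 3"
      using eps_pos by (intro mult_left_mono) (auto simp: power_numeral_reduce)
    then show "64 * (d * \<beta>) \<le> \<epsilon>"
      using d2 unfolding eq by (simp add: field_simps power2_eq_square)
    have "2 * \<epsilon>\<^sup>2 \<le> real d * real d ^ 2"
      using d2 eps_le eps_pos by (intro mult_mono power_mono) auto
    then show "32 * (d * \<beta>) \<le> 1"
      using d2 unfolding eq by (simp add: field_simps power_numeral_reduce)
  qed
  have scale: "64 * real e \<le> \<epsilon> * u" "32 * e \<le> u" if "real e \<le> card S * \<beta> * real u" for e u :: nat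
  proof -
    have "64 * (d * \<beta>) * u \<le> \<epsilon> * u" "32 * (d * \<beta>) * u \<le> 1 * real u"
      using d\<beta> by (intro mult_right_mono; simp)+
    then show "64 * real e \<le> \<epsilon> * u" "32 * e \<le> u" using that assms(8) by auto
  qed
  obtain f :: "'a \<Rightarrow> real" where f_nz: "\<exists>g\<in>carrier G. f g \<noteq> 0"
    and f: "\<And>g. g \<in> carrier G \<Longrightarrow> (\<Sum>s\<in>S. f (inv g \<otimes> s)) = card S * \<mu> * f g"
    using eigenvalue_imp_eigenfunction[OF assms(12,13) S_ne assms(14)] by blast
  have f': "(\<Sum>s\<in>S. f (g \<otimes> s)) = card S * \<mu> * f (inv g)" if "g \<in> carrier G" for g
    using f[of "inv g"] that by simp
  have bound: "card S * (1 - \<beta>\<^sup>2 / 2) \<le> - (card S * \<mu>)"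
  proof -
    have "card S * (1 - \<beta>\<^sup>2 / 2) \<le> card S * (- \<mu>)"
      using \<mu> unfolding \<beta>_sq by (intro mult_left_mono) auto
    then show ?thesis by simp
  qed
  \<comment> \<open>Twice the even part of \<open>f\<close>. If it is nonzero, it is a Cayley
    eigenfunction for \<open>card S * \<mu>\<close>, near -d; if it vanishes, \<open>f\<close> is
    odd and belongs to the opposite eigenvalue, near d.\<close>
  define e where "e g = f g + f (inv g)" for g
  show False
  proof (cases "\<exists>g\<in>carrier G. e g \<noteq> 0")
    case True
    have "(\<Sum>s\<in>S. e (g \<otimes> s)) = card S * \<mu> * e g" if "g \<in> carrier G" for g
      using f[OF that] f'[OF that] sum_S_inverse_conj[OF that, of f]
      by (simp add: e_def sum.distrib algebra_simps)
    then obtain t where t: "support (level_sign e t) \<noteq> {}"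
      "card (mismatch (- 1) (level_sign e t)) \<le> card S * \<beta> * card (support (level_sign e t))"
      using exists_level_sign_mismatch[of "- 1" \<beta> e "card S * \<mu>"] \<beta>_pos bound True by auto
    have "level_sign e t g \<in> {- 1, 0, 1}" for g by (simp add: level_sign_def sgn_if)
    from alternating_sign_bipartite[OF this t(1) scale[OF t(2)]] show False
      using assms(11) by simp
  next
    case False
    then have odd: "f (inv g) = - f g" if "g \<in> carrier G" for g
      using that by (simp add: e_def add_eq_0_iff)
    have "(\<Sum>s\<in>S. f (g \<otimes> s)) = - (card S * \<mu>) * f g" if "g \<in> carrier G" for g
      using f'[OF that] odd[OF that] by simp
    then obtain t where t: "support (level_sign f t) \<noteq> {}"
      "card (mismatch 1 (level_sign f t)) \<le> card S * \<beta> * card (support (level_sign f t))"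
      using exists_level_sign_mismatch[of 1 \<beta> f "- (card S * \<mu>)"] \<beta>_pos bound f_nz by auto
    have "level_sign f t (inv g) = - level_sign f t g" if "g \<in> carrier G" for g
      using odd[OF that] by (simp add: level_sign_def sgn_minus)
    from odd_sign_mismatch[OF this t(1) scale[OF t(2)]] show False .
  qed
qed

end
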